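(* Let $\vec{x}=(x_1,\ldots,x_t)$ be a generalized Catalan list of nonzero integers with $2y$ runs. If ${\sf cost}(\vec{x})={\sf width}(\vec{x})$ and $y>1$, then $\vec{x}$ is reducible.
   Context: A list $\vec{x}=(x_1,\ldots,x_t)$ of nonzero integers is generalized Catalan if $\sum_{i=1}^t x_i=0$ and $\sum_{i=1}^q x_i\ge0$ for all $1\le q\le t$. A sublist is $(x_{i_1},\ldots,x_{i_a})$ with $i_1<\cdots<i_a$; its complementary sublist consists of the remaining entries in order. $\vec{x}$ is reducible if there is a generalized Catalan sublist whose complementary sublist is also generalized Catalan. A run is a maximal consecutive sublist of entries of the same sign; a generalized Catalan list has an even number $2y$ of runs. If $a_k>0$ is the maximum absolute value of an entry in the $k$-th run, ${\sf cost}(\vec{x})=\sum_{k=1}^{2y}a_k$ and ${\sf width}(\vec{x})=t$. *)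

theory Defs
  imports Main
begin

definition gen_catalan :: "int list \<Rightarrow> bool" where
  "gen_catalan xs \<longleftrightarrow>
     0 \<notin> set xs \<and> sum_list xs = 0 \<and>
     (\<forall>q. 1 \<le> q \<and> q \<le> length xs \<longrightarrow> sum_list (take q xs) \<ge> 0)"

(* The empty list satisfies gen_catalan. Both the sublist and its complement are required to be
   nonempty; otherwise every generalized Catalan list would be reducible. *)
definition reducible :: "int list \<Rightarrow> bool" where
  "reducible xs \<longleftrightarrow>
     (\<exists>I. nths xs I \<noteq> [] \<and> nths xs (- I) \<noteq> [] \<and>
          gen_catalan (nths xs I) \<and> gen_catalan (nths xs (- I)))"

function runs :: "int list \<Rightarrow> int list list" where
  "runs [] = []"
| "runs (x # xs) =
     (x # takeWhile (\<lambda>y. sgn y = sgn x) xs) # runs (dropWhile (\<lambda>y. sgn y = sgn x) xs)"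
  by pat_completeness auto
termination
  by (relation "measure length") (auto simp: le_imp_less_Suc length_dropWhile_le)

definition cost :: "int list \<Rightarrow> int" where
  "cost xs = (\<Sum>k<length (runs xs). Max (abs ` set (runs xs ! k)))"

definition width :: "int list \<Rightarrow> nat" where
  "width xs = length xs"

lemma concat_runs: "concat (runs xs) = xs"
  by (induction xs rule: runs.induct) auto

lemma runs_same_sign:
  "r \<in> set (runs xs) \<Longrightarrow> r \<noteq> [] \<and> (\<exists>s. \<forall>x\<in>set r. sgn x = s)"
proof (induction xs rule: runs.induct)
  case 1
  then show ?case by simp
next
  case (2 x xs)
  let ?t = "x # takeWhile (\<lambda>y. sgn y = sgn x) xs"
  consider "r = ?t" | "r \<in> set (runs (dropWhile (\<lambda>y. sgn y = sgn x) xs))"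
    using "2.prems" by auto
  then show ?case
  proof cases
    case 1
    have "\<forall>y\<in>set ?t. sgn y = sgn x"
      by (metis (mono_tags, lifting) set_ConsD set_takeWhileD)
    with 1 show ?thesis by blast
  next
    case 2
    with "2.IH" show ?thesis by blast
  qed
qed

lemma hd_hd_runs: "xs \<noteq> [] \<Longrightarrow> hd (hd (runs xs)) = hd xs"
  by (cases xs) auto

lemma runs_maximal:
  "Suc k < length (runs xs) \<Longrightarrow> sgn (hd (runs xs ! k)) \<noteq> sgn (hd (runs xs ! Suc k))"
proof (induction xs arbitrary: k rule: runs.induct)
  case 1
  then show ?case by simp
next
  case (2 x xs)
  let ?d = "dropWhile (\<lambda>y. sgn y = sgn x) xs"
  show ?case
  proof (cases k)
    case 0
    with "2.prems" have "runs ?d \<noteq> []" by auto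
    then have d: "?d \<noteq> []" by (metis runs.simps(1))
    have "sgn (hd ?d) \<noteq> sgn x" by (rule hd_dropWhile[OF d])
    moreover have "hd (runs ?d ! 0) = hd ?d"
      using hd_hd_runs[OF d] hd_conv_nth[OF \<open>runs ?d \<noteq> []\<close>] by metis
    ultimately have "sgn (hd (runs ?d ! 0)) \<noteq> sgn x" by metis
    with 0 show ?thesis by simp
  next
    case (Suc j)
    with "2.prems" have "Suc j < length (runs ?d)" by simp
    from "2.IH"[OF this] Suc show ?thesis by simp
  qed
qed

end

theory Submission
  imports Defs
begin

text \<open>
  Traverse the entries by a greedy walk that starts at level 0: at a positive level take the next
  unused negative entry, otherwise the next unused positive one. Since the partial sums of the list
  are nonnegative, the walk is never ahead in its positive entries: it enters a positive run only
  after exhausting all earlier negative runs. Two distinct times of equal level \<open>v\<close> cut out a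
  zero-sum sublist, and this sublist and its complement are both generalized Catalan provided that
  \<open>v > 0\<close> and the last positive entries taken at the two times lie in the same run, or \<open>v < 0\<close> and
  the last negative entries taken lie in the same run, or \<open>v = 0\<close>.
  A positive run with maximum \<open>m\<close> only sees the levels \<open>1, \<dots>, m\<close>, and a negative run with maximal
  absolute value \<open>m\<close> only the levels \<open>1 - m, \<dots>, -1\<close>. So an irreducible list with \<open>2y\<close> runs has at
  most \<open>cost - y + 1\<close> times, which is less than the cost for \<open>y > 1\<close>.
\<close>

section \<open>Sublists, complements and their partial sums\<close>

lemma sum_list_nths_Compl:
  "sum_list (nths xs I) + sum_list (nths xs (- I)) = sum_list (xs :: int list)"
proof (induction xs rule: rev_induct)
  case (snoc x xs)
  then show ?case by (auto simp: nths_append nths_singleton)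
qed simp

lemma take_nths_obtain:
  obtains r where "r \<le> length xs" "take q (nths xs I) = nths (take r xs) I"
proof -
  have "\<exists>r\<le>length xs. take q (nths xs I) = nths (take r xs) I"
  proof (induction xs rule: rev_induct)
    case (snoc x xs)
    show ?case
    proof (cases "q \<le> length (nths xs I)")
      case True
      then obtain r where "r \<le> length xs" "take q (nths xs I) = nths (take r xs) I"
        using snoc by blast
      then show ?thesis using True by (intro exI[of _ r]) (simp add: nths_append)
    next
      case False
      then have "take q (nths (xs @ [x]) I) = nths (xs @ [x]) I"
        by (auto simp: nths_append nths_singleton)
      then show ?thesis by (intro exI[of _ "length (xs @ [x])"]) simp
    qed
  qed simp
  then show ?thesis using that by blast
qed

lemma gen_catalan_nths:
  assumes "0 \<notin> set xs" "sum_list (nths xs I) = 0"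
    and "\<And>q. q \<le> length xs \<Longrightarrow> 0 \<le> sum_list (nths (take q xs) I)"
  shows "gen_catalan (nths xs I)"
  unfolding gen_catalan_def
proof (intro conjI allI impI)
  show "0 \<notin> set (nths xs I)" using assms(1) by (meson notin_set_nthsI)
  show "sum_list (nths xs I) = 0" by fact
  fix q
  obtain r where "r \<le> length xs" "take q (nths xs I) = nths (take r xs) I"
    by (rule take_nths_obtain)
  with assms(3) show "0 \<le> sum_list (take q (nths xs I))" by simp
qed

text \<open>The lower bound is the Catalan condition for the sublist, the upper bound that for its
  complement; at \<open>q = length xs\<close> both force sum 0. The indices \<open>i\<close> and
  \<open>j\<close> make the two sublists nonempty.\<close>

lemma reducibleI:
  assumes "gen_catalan xs" "i < length xs" "i \<in> I" "j < length xs" "j \<notin> I"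
    and between: "\<And>q. q \<le> length xs \<Longrightarrow> 0 \<le> sum_list (nths (take q xs) I)
      \<and> sum_list (nths (take q xs) I) \<le> sum_list (take q xs)"
  shows "reducible xs"
proof -
  have nz: "0 \<notin> set xs" and sum: "sum_list xs = 0"
    using assms(1) by (auto simp: gen_catalan_def)
  have "sum_list (nths xs I) = 0" using between[of "length xs"] sum by simp
  moreover have "sum_list (nths xs (- I)) = 0"
    using sum_list_nths_Compl[of xs I] calculation sum by simp
  moreover have "0 \<le> sum_list (nths (take q xs) (- I))" if "q \<le> length xs" for q
    using sum_list_nths_Compl[of "take q xs" I] between[OF that] by linarith
  moreover have "xs ! i \<in> set (nths xs I)" "xs ! j \<in> set (nths xs (- I))"
    using assms(2-5) by (auto simp: set_nths)
  then have "nths xs I \<noteq> []" "nths xs (- I) \<noteq> []" by force+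
  ultimately show ?thesis
    unfolding reducible_def using gen_catalan_nths[OF nz] between by blast
qed

section \<open>Ranks of entries among those of the same kind\<close>

text \<open>If \<open>R (xs ! q)\<close>, this is the 0-based rank of that entry in
  \<open>filter R xs\<close>.\<close>

definition count :: "('a \<Rightarrow> bool) \<Rightarrow> 'a list \<Rightarrow> nat \<Rightarrow> nat" where
  "count R xs q = length (filter R (take q xs))"

lemma count_Suc:
  "q < length xs \<Longrightarrow> count R xs (Suc q) = (if R (xs ! q) then Suc (count R xs q) else count R xs q)"
  by (simp add: count_def take_Suc_conv_app_nth)

lemma count_mono: "q \<le> r \<Longrightarrow> count R xs q \<le> count R xs r"
  unfolding count_def by (metis append_take_drop_id filter_append le_add1 length_append min.absorb1 take_take)

lemma count_le: "count R xs q \<le> length (filter R xs)"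
  unfolding count_def by (metis append_take_drop_id filter_append le_add1 length_append)

lemma count_less_iff:
  assumes "R (xs ! p)" "p < length xs"
  shows "count R xs p < count R xs q \<longleftrightarrow> p < q"
proof
  assume "p < q"
  then have "count R xs (Suc p) \<le> count R xs q" by (intro count_mono) simp
  then show "count R xs p < count R xs q" using assms by (simp add: count_Suc)
qed (meson count_mono leD not_le_imp_less)

lemma take_count_filter: "take (count R xs q) (filter R xs) = filter R (take q xs)"
proof -
  have "filter R xs = filter R (take q xs) @ filter R (drop q xs)"
    by (metis append_take_drop_id filter_append)
  then show ?thesis by (simp add: count_def)
qed

lemma count_cong:
  assumes "q \<le> r" "r \<le> length xs" "\<And>m. q \<le> m \<Longrightarrow> m < r \<Longrightarrow> \<not> R (xs ! m)"
  shows "count R xs r = count R xs q"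
  using assms
proof (induction r rule: dec_induct)
  case (step n)
  then show ?case by (simp add: count_Suc)
qed simp

lemma filter_nth_obtain:
  assumes "j < length (filter R xs)"
  obtains p where "p < length xs" "R (xs ! p)" "count R xs p = j" "filter R xs ! j = xs ! p"
proof -
  have "\<exists>p<length xs. R (xs ! p) \<and> count R xs p = j \<and> filter R xs ! j = xs ! p"
    using assms
  proof (induction xs rule: rev_induct)
    case (snoc x xs)
    show ?case
    proof (cases "j < length (filter R xs)")
      case True
      then obtain p where "p < length xs" "R (xs ! p)" "count R xs p = j" "filter R xs ! j = xs ! p"
        using snoc.IH by blast
      then show ?thesis using True
        by (intro exI[of _ p]) (auto simp: count_def nth_append)
    next
      case False
      then have "R x" "j = length (filter R xs)"
        using snoc.prems by (auto split: if_splits)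
      then show ?thesis by (intro exI[of _ "length xs"]) (simp add: count_def)
    qed
  qed simp
  then show ?thesis using that by blast
qed

section \<open>Separate sums over the positive and the negative entries\<close>

definition pos_sum :: "int list \<Rightarrow> nat \<Rightarrow> int" where
  "pos_sum xs a = sum_list (take a (filter (\<lambda>x. 0 < x) xs))"

definition neg_sum :: "int list \<Rightarrow> nat \<Rightarrow> int" where
  "neg_sum xs b = - sum_list (take b (filter (\<lambda>x. x < 0) xs))"

abbreviation num_pos :: "int list \<Rightarrow> nat" where
  "num_pos xs \<equiv> length (filter (\<lambda>x. 0 < x) xs)"

abbreviation num_neg :: "int list \<Rightarrow> nat" where
  "num_neg xs \<equiv> length (filter (\<lambda>x. x < 0) xs)"

lemma pos_sum_Suc:
  assumes "a < num_pos xs"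
  shows "pos_sum xs (Suc a) = pos_sum xs a + filter (\<lambda>x. 0 < x) xs ! a"
  using assms by (simp add: pos_sum_def take_Suc_conv_app_nth)

lemma neg_sum_Suc:
  assumes "b < num_neg xs"
  shows "neg_sum xs (Suc b) = neg_sum xs b - filter (\<lambda>x. x < 0) xs ! b"
  using assms by (simp add: neg_sum_def take_Suc_conv_app_nth)

lemma pos_sum_strict:
  assumes "a < a'" "a' \<le> num_pos xs"
  shows "pos_sum xs a < pos_sum xs a'"
proof -
  have incr: "pos_sum xs c < pos_sum xs (Suc c)" if "c < num_pos xs" for c
    using nth_mem[OF that] that by (simp add: pos_sum_Suc)
  from assms have "Suc a \<le> a'" by simp
  from this assms(2) show ?thesis
  proof (induction a' rule: dec_induct)
    case (step n)
    then show ?case using incr[of n] by simp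
  qed (use incr in simp)
qed

lemma neg_sum_strict:
  assumes "b < b'" "b' \<le> num_neg xs"
  shows "neg_sum xs b < neg_sum xs b'"
proof -
  have incr: "neg_sum xs c < neg_sum xs (Suc c)" if "c < num_neg xs" for c
    using nth_mem[OF that] that by (simp add: neg_sum_Suc)
  from assms have "Suc b \<le> b'" by simp
  from this assms(2) show ?thesis
  proof (induction b' rule: dec_induct)
    case (step n)
    then show ?case using incr[of n] by simp
  qed (use incr in simp)
qed

lemma pos_sum_le_iff:
  "a \<le> num_pos xs \<Longrightarrow> a' \<le> num_pos xs \<Longrightarrow> pos_sum xs a \<le> pos_sum xs a' \<longleftrightarrow> a \<le> a'"
  by (metis linorder_not_le nle_le order_less_imp_le pos_sum_strict)

lemma neg_sum_le_iff:
  "b \<le> num_neg xs \<Longrightarrow> b' \<le> num_neg xs \<Longrightarrow> neg_sum xs b \<le> neg_sum xs b' \<longleftrightarrow> b \<le> b'"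
  by (metis linorder_not_le nle_le order_less_imp_le neg_sum_strict)

lemma length_eq_num_pos_neg: "0 \<notin> set xs \<Longrightarrow> length xs = num_pos xs + num_neg xs"
  by (induction xs) auto

lemma sum_list_filter_pos_neg:
  "sum_list xs = sum_list (filter (\<lambda>x. 0 < x) xs) + sum_list (filter (\<lambda>x. x < 0) (xs :: int list))"
  by (induction xs) auto

abbreviation cpos :: "int list \<Rightarrow> nat \<Rightarrow> nat" where
  "cpos \<equiv> count (\<lambda>x. 0 < x)"

abbreviation cneg :: "int list \<Rightarrow> nat \<Rightarrow> nat" where
  "cneg \<equiv> count (\<lambda>x. x < 0)"

lemma sum_list_take_eq: "sum_list (take q xs) = pos_sum xs (cpos xs q) - neg_sum xs (cneg xs q)"
  using sum_list_filter_pos_neg[of "take q xs"]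
  by (simp add: pos_sum_def neg_sum_def take_count_filter)

text \<open>For two states of the walk: the positions whose entries it takes between them.\<close>

definition window :: "int list \<Rightarrow> nat \<Rightarrow> nat \<Rightarrow> nat \<Rightarrow> nat \<Rightarrow> nat set" where
  "window xs a a' b b' = {i. (0 < xs ! i \<and> a \<le> cpos xs i \<and> cpos xs i < a') \<or>
                             (xs ! i < 0 \<and> b \<le> cneg xs i \<and> cneg xs i < b')}"

lemma nths_take_Suc:
  assumes "q < length xs"
  shows "nths (take (Suc q) xs) I = nths (take q xs) I @ (if q \<in> I then [xs ! q] else [])"
  using assms by (simp add: take_Suc_conv_app_nth nths_append nths_singleton)

text \<open>The window is the set of ranks below \<open>(a', b')\<close> minus the set below
  \<open>(a, b)\<close>; each of these meets a prefix in an initial part of either sign, whose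
  length is the \<open>min\<close>.\<close>

lemma sum_list_nths_window:
  assumes "a \<le> a'" "b \<le> b'" "q \<le> length xs"
  shows "sum_list (nths (take q xs) (window xs a a' b b')) =
      (pos_sum xs (min (cpos xs q) a') - neg_sum xs (min (cneg xs q) b'))
    - (pos_sum xs (min (cpos xs q) a) - neg_sum xs (min (cneg xs q) b))"
  using assms(3)
proof (induction q)
  case 0
  then show ?case by (simp add: count_def)
next
  case (Suc q)
  then have q: "q < length xs" by simp
  let ?A = "cpos xs q" and ?B = "cneg xs q"
  have IH: "sum_list (nths (take q xs) (window xs a a' b b')) =
      (pos_sum xs (min ?A a') - neg_sum xs (min ?B b'))
    - (pos_sum xs (min ?A a) - neg_sum xs (min ?B b))"
    using Suc by simp
  consider "0 < xs ! q" | "xs ! q < 0" | "xs ! q = 0" by linarith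
  then show ?case
  proof cases
    case 1
    have "pos_sum xs (Suc ?A) = pos_sum xs ?A + xs ! q"
      using sum_list_take_eq[of "Suc q" xs] sum_list_take_eq[of q xs] q 1
      by (simp add: count_Suc take_Suc_conv_app_nth)
    then have "pos_sum xs (min (Suc ?A) c) = pos_sum xs (min ?A c) + (if ?A < c then xs ! q else 0)" for c
      by (simp add: min_def)
    then show ?thesis using IH 1 q assms(1,2)
      by (simp add: nths_take_Suc count_Suc window_def)
  next
    case 2
    have "neg_sum xs (Suc ?B) = neg_sum xs ?B - xs ! q"
      using sum_list_take_eq[of "Suc q" xs] sum_list_take_eq[of q xs] q 2
      by (simp add: count_Suc take_Suc_conv_app_nth)
    then have "neg_sum xs (min (Suc ?B) c) = neg_sum xs (min ?B c) - (if ?B < c then xs ! q else 0)" for c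
      by (simp add: min_def)
    then show ?thesis using IH 2 q assms(1,2)
      by (simp add: nths_take_Suc count_Suc window_def)
  next
    case 3
    then show ?thesis using IH q by (simp add: nths_take_Suc count_Suc)
  qed
qed

section \<open>States of the greedy walk\<close>

text \<open>These two conditions characterise the states reached by the greedy walk after taking \<open>a\<close>
  positive and \<open>b\<close> negative entries: the positive entry of rank \<open>A\<close> is taken at a level \<open>\<le> 0\<close>, the
  negative entry of rank \<open>B\<close> at a level \<open>> 0\<close>.\<close>

definition greedy :: "int list \<Rightarrow> nat \<Rightarrow> nat \<Rightarrow> bool" where
  "greedy xs a b \<longleftrightarrow> a \<le> num_pos xs \<and> b \<le> num_neg xs \<and>
     (\<forall>A<a. pos_sum xs A \<le> neg_sum xs b) \<and> (\<forall>B<b. neg_sum xs B < pos_sum xs a)"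

definition level :: "int list \<Rightarrow> nat \<Rightarrow> nat \<Rightarrow> int" where
  "level xs a b = pos_sum xs a - neg_sum xs b"

lemma greedy_level_pos: "greedy xs a b \<Longrightarrow> 0 < level xs a b \<Longrightarrow> a \<noteq> 0"
  using neg_sum_le_iff[of 0 xs b] by (cases a) (auto simp: greedy_def level_def pos_sum_def neg_sum_def)

lemma greedy_level_neg: "greedy xs a b \<Longrightarrow> level xs a b < 0 \<Longrightarrow> b \<noteq> 0"
  using pos_sum_le_iff[of 0 xs a] by (cases b) (auto simp: greedy_def level_def pos_sum_def neg_sum_def)

text \<open>The induction takes one step of the walk. As positive and negative entries have equal
  totals, the sign demanded by the level has not run out.\<close>

lemma greedy_exists:
  assumes "sum_list xs = 0" "t \<le> num_pos xs + num_neg xs"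
  shows "\<exists>a b. a + b = t \<and> greedy xs a b"
  using assms(2)
proof (induction t)
  case 0
  then show ?case by (simp add: greedy_def)
next
  case (Suc t)
  then obtain a b where ab: "a + b = t" "greedy xs a b" by auto
  have total: "pos_sum xs (num_pos xs) = neg_sum xs (num_neg xs)"
    using sum_list_filter_pos_neg[of xs] assms(1) by (simp add: pos_sum_def neg_sum_def)
  show ?case
  proof (cases "pos_sum xs a \<le> neg_sum xs b")
    case True
    have "a < num_pos xs"
    proof (rule ccontr)
      assume "\<not> a < num_pos xs"
      then have "a = num_pos xs" using ab by (simp add: greedy_def)
      then have "num_neg xs \<le> b"
        using True total ab neg_sum_le_iff[of "num_neg xs" xs b] by (simp add: greedy_def)
      then show False using \<open>a = num_pos xs\<close> ab Suc.prems by simp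
    qed
    moreover have "pos_sum xs a < pos_sum xs (Suc a)"
      using calculation by (simp add: pos_sum_strict)
    ultimately have "greedy xs (Suc a) b"
      using ab True by (auto simp: greedy_def less_Suc_eq intro: less_trans)
    then show ?thesis using ab by (intro exI[of _ "Suc a"] exI[of _ b]) simp
  next
    case False
    have "b < num_neg xs"
    proof (rule ccontr)
      assume "\<not> b < num_neg xs"
      then have "b = num_neg xs" using ab by (simp add: greedy_def)
      then have "num_pos xs < a"
        using False total ab pos_sum_le_iff[of a xs "num_pos xs"] by (simp add: greedy_def)
      then show False using ab by (simp add: greedy_def)
    qed
    moreover have "neg_sum xs b < neg_sum xs (Suc b)"
      using calculation by (simp add: neg_sum_strict)
    ultimately have "greedy xs a (Suc b)"
      using ab False by (fastforce simp: greedy_def less_Suc_eq)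
    then show ?thesis using ab by (intro exI[of _ a] exI[of _ "Suc b"]) simp
  qed
qed

text \<open>If the states crossed, the smaller of \<open>a\<close>, \<open>a'\<close> and the
  smaller of \<open>b\<close>, \<open>b'\<close> would satisfy contradictory inequalities between
  \<open>pos_sum\<close> and \<open>neg_sum\<close>.\<close>

lemma greedy_chain:
  assumes "greedy xs a b" "greedy xs a' b'" "a + b \<le> a' + b'"
  shows "a \<le> a'" "b \<le> b'"
proof -
  have "\<not> (a' < a \<and> b < b')" "\<not> (a < a' \<and> b' < b)"
    using assms(1,2) unfolding greedy_def by (meson not_le)+
  then show "a \<le> a'" "b \<le> b'" using assms(3) by linarith+
qed

text \<open>A prefix of the list with \<open>A\<close> positive and \<open>B\<close> negative entries contributes the sum \<open>F\<close> to the
  window. The assumptions \<open>up\<close> and \<open>dn\<close> are nonnegativity of the partial sums after shortening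
  (resp. extending) the prefix inside the run in which it ends.\<close>

lemma window_sum_bounds:
  assumes g: "greedy xs a b" "greedy xs a' b'"
    and le: "a \<le> a'" "b \<le> b'"
    and lev: "level xs a b = level xs a' b'"
    and A: "A \<le> num_pos xs" and B: "B \<le> num_neg xs"
    and AB: "neg_sum xs B \<le> pos_sum xs A"
    and up: "0 < level xs a b \<Longrightarrow> a \<le> A \<Longrightarrow> A < a' \<Longrightarrow> neg_sum xs B \<le> pos_sum xs (a - 1)"
    and dn: "level xs a b < 0 \<Longrightarrow> b \<le> B \<Longrightarrow> B < b' \<Longrightarrow> neg_sum xs b' \<le> pos_sum xs A"
  defines "F \<equiv> (pos_sum xs (min A a') - neg_sum xs (min B b'))
              - (pos_sum xs (min A a) - neg_sum xs (min B b))"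
  shows "0 \<le> F" and "F \<le> pos_sum xs A - neg_sum xs B"
proof -
  have bd: "a \<le> num_pos xs" "a' \<le> num_pos xs" "b \<le> num_neg xs" "b' \<le> num_neg xs"
    using g by (auto simp: greedy_def)
  note P = pos_sum_le_iff[of _ xs] and N = neg_sum_le_iff[of _ xs]
  \<comment> \<open>\<open>greedy\<close> bounds \<open>pos_sum xs A\<close> by
    \<open>neg_sum xs b\<close>, so by \<open>AB\<close> a prefix lacking one of the first
    \<open>a\<close> positive entries has at most \<open>b\<close> negative ones.\<close>
  have W: "B \<le> b" if "A < a"
    using that g(1) AB N[OF B bd(3)] by (force simp: greedy_def)
  have W': "B \<le> b'" if "A < a'"
    using that g(2) AB N[OF B bd(4)] by (force simp: greedy_def)
  have up': "\<not> (0 < level xs a b \<and> a \<le> A \<and> A < a' \<and> b < B)"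
  proof
    assume *: "0 < level xs a b \<and> a \<le> A \<and> A < a' \<and> b < B"
    have "a \<noteq> 0" using greedy_level_pos[OF g(1)] * by blast
    then have "pos_sum xs (a - 1) \<le> neg_sum xs b" using g(1) by (simp add: greedy_def)
    then have "neg_sum xs B \<le> neg_sum xs b" using up * by linarith
    then show False using * N[OF B bd(3)] by simp
  qed
  show "0 \<le> F"
  proof (cases "B \<le> b")
    case True
    then have "F = pos_sum xs (min A a') - pos_sum xs (min A a)"
      using le by (simp add: F_def)
    moreover have "pos_sum xs (min A a) \<le> pos_sum xs (min A a')"
      using P[of "min A a" "min A a'"] A le bd by simp
    ultimately show ?thesis by simp
  next
    case False
    show ?thesis
    proof (cases "A < a'")
      case True
      have "a \<le> A" using W False by force
      then have "level xs a b \<le> 0" using up' True False by force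
      \<comment> \<open>Here \<open>F\<close> is the prefix sum minus the level, the former
        nonnegative and the latter nonpositive.\<close>
      then show ?thesis
        using False True \<open>a \<le> A\<close> W' AB by (simp add: F_def level_def)
    next
      case A': False
      have "neg_sum xs (min B b') \<le> neg_sum xs b'"
        using N[of "min B b'" b'] B bd by simp
      then show ?thesis using False A' le lev by (simp add: F_def level_def)
    qed
  qed
  show "F \<le> pos_sum xs A - neg_sum xs B"
  proof (cases "A < a")
    case True
    then show ?thesis using W le AB by (simp add: F_def)
  next
    case aA: False
    have PA: "pos_sum xs (min A a') \<le> pos_sum xs A"
      using P[of "min A a'" A] A bd by simp
    consider "B < b" | "b \<le> B" "0 \<le> level xs a b" "B \<le> b'" | "b' < B"
      | "b \<le> B" "level xs a b < 0" "B \<le> b'"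
      using le by linarith
    then show ?thesis
    proof cases
      case 1
      then have "neg_sum xs B < pos_sum xs a" using g(1) by (simp add: greedy_def)
      then show ?thesis using 1 aA le PA by (simp add: F_def)
    next
      case 2
      then show ?thesis using aA PA by (simp add: F_def level_def)
    next
      case 3
      then have "a' \<le> A" using W' by force
      then show ?thesis using 3 lev le AB by (simp add: F_def level_def)
    next
      case 4
      \<comment> \<open>Completing the negative part of the window keeps the sum nonnegative. As the
        level is negative, this puts the first \<open>a'\<close> positive entries into the prefix,
        and \<open>F\<close> becomes \<open>neg_sum xs b' - neg_sum xs B\<close>.\<close>
      have *: "neg_sum xs b' \<le> pos_sum xs A" using dn AB 4 by (cases "B = b'") auto
      have "a' \<le> A"
      proof (rule ccontr)
        assume "\<not> a' \<le> A"
        then have "pos_sum xs A < pos_sum xs a'" using bd by (simp add: pos_sum_strict)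
        then show False using * 4 lev by (simp add: level_def)
      qed
      then show ?thesis using * 4 aA le lev by (simp add: F_def level_def)
    qed
  qed
qed

section \<open>Collisions of levels within a run\<close>

text \<open>For \<open>xss = runs xs\<close>, \<open>f\<close> gives the index of the run containing
  a position. By monotonicity, all positions between two of the same run belong to it.\<close>

lemma concat_index_exists:
  "\<exists>f. (\<forall>i<length (concat xss). f i < length xss \<and> concat xss ! i \<in> set (xss ! f i)) \<and>
       (\<forall>i j. i \<le> j \<longrightarrow> f i \<le> (f j :: nat))"
proof (induction xss)
  case (Cons ys xss)
  then obtain f where f: "\<And>i. i < length (concat xss) \<Longrightarrow>
      f i < length xss \<and> concat xss ! i \<in> set (xss ! f i)" "\<And>i j. i \<le> j \<Longrightarrow> f i \<le> f j"
    by blast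
  define g where "g i = (if i < length ys then 0 else Suc (f (i - length ys)))" for i
  have "g i < length (ys # xss) \<and> concat (ys # xss) ! i \<in> set ((ys # xss) ! g i)"
    if "i < length (concat (ys # xss))" for i
  proof (cases "i < length ys")
    case False
    then have "i - length ys < length (concat xss)" using that by simp
    from f(1)[OF this] show ?thesis using False by (simp add: g_def nth_append)
  qed (simp add: g_def nth_append)
  moreover have "g i \<le> g j" if "i \<le> j" for i j
    using that f(2)[of "i - length ys" "j - length ys"] by (simp add: g_def diff_le_mono)
  ultimately show ?case by blast
qed (auto intro: exI[of _ "\<lambda>_. 0"])

text \<open>The window between the two times is the splitting sublist. In \<open>up\<close> and
  \<open>dn\<close>, \<open>p\<close> and \<open>p'\<close> are the positions of the last entries of
  that sign taken at the two times.\<close>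

lemma reducible_collision:
  assumes gc: "gen_catalan xs"
    and g: "greedy xs a b" "greedy xs a' b'"
    and lt: "a + b < a' + b'" and fin: "a' + b' < length xs"
    and lev: "level xs a b = level xs a' b'"
    and up: "0 < level xs a b \<Longrightarrow> \<exists>p p'. p < length xs \<and> p' < length xs \<and>
      cpos xs p = a - 1 \<and> cpos xs p' = a' - 1 \<and> 0 < xs ! p' \<and> 0 < xs ! p \<and>
      (\<forall>m. p \<le> m \<and> m \<le> p' \<longrightarrow> 0 < xs ! m)"
    and dn: "level xs a b < 0 \<Longrightarrow> \<exists>p p'. p < length xs \<and> p' < length xs \<and>
      cneg xs p = b - 1 \<and> cneg xs p' = b' - 1 \<and> xs ! p' < 0 \<and> xs ! p < 0 \<and>
      (\<forall>m. p \<le> m \<and> m \<le> p' \<longrightarrow> xs ! m < 0)"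
  shows "reducible xs"
proof -
  have le: "a \<le> a'" "b \<le> b'" using greedy_chain[OF g] lt by simp_all
  have bd: "a' \<le> num_pos xs" "b' \<le> num_neg xs" using g by (auto simp: greedy_def)
  let ?I = "window xs a a' b b'"
  have nz: "0 \<notin> set xs" using gc by (simp add: gen_catalan_def)
  have ht: "neg_sum xs (cneg xs q) \<le> pos_sum xs (cpos xs q)" if "q \<le> length xs" for q
  proof (cases "q = 0")
    case False
    then have "0 \<le> sum_list (take q xs)" using gc that by (simp add: gen_catalan_def)
    then show ?thesis by (simp add: sum_list_take_eq)
  qed (simp add: count_def pos_sum_def neg_sum_def)
  obtain i where i: "i < length xs" "i \<in> ?I"
  proof (cases "a < a'")
    case True
    then have "a < num_pos xs" using bd by simp
    then show ?thesis using that True by (auto elim!: filter_nth_obtain simp: window_def)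
  next
    case False
    then have "b < b'" using lt le by simp
    moreover from this have "b < num_neg xs" using bd by simp
    ultimately show ?thesis using that by (auto elim!: filter_nth_obtain simp: window_def)
  qed
  note len = length_eq_num_pos_neg[OF nz]
  \<comment> \<open>By \<open>fin\<close> some entry is not yet taken at the second time, so rank
    \<open>a'\<close> or rank \<open>b'\<close> exists; it lies outside the window.\<close>
  obtain j where j: "j < length xs" "j \<notin> ?I"
  proof (cases "a' < num_pos xs")
    case True
    then show ?thesis using that by (auto elim!: filter_nth_obtain simp: window_def)
  next
    case False
    then have "b' < num_neg xs" using fin len bd by simp
    then show ?thesis using that by (auto elim!: filter_nth_obtain simp: window_def)
  qed
  show ?thesis
  proof (rule reducibleI[OF gc i j])
    fix q
    assume q: "q \<le> length xs"
    let ?A = "cpos xs q" and ?B = "cneg xs q"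
    \<comment> \<open>The prefix ends between \<open>p\<close> and \<open>p'\<close>. Cutting it
      back to length \<open>p\<close> drops only positive entries and leaves \<open>a - 1\<close> of
      them.\<close>
    have up': "neg_sum xs ?B \<le> pos_sum xs (a - 1)"
      if lev_ab: "0 < level xs a b" and ran: "a \<le> ?A" "?A < a'"
    proof -
      obtain p p' where p: "p < length xs" "p' < length xs"
        "cpos xs p = a - 1" "cpos xs p' = a' - 1" "0 < xs ! p'" "0 < xs ! p"
        "\<And>m. p \<le> m \<Longrightarrow> m \<le> p' \<Longrightarrow> 0 < xs ! m"
        using up[OF lev_ab] by blast
      have "a \<noteq> 0" using greedy_level_pos[OF g(1)] lev_ab by blast
      then have "p < q" using count_less_iff[of "\<lambda>x. 0 < x" xs p q] p ran by linarith
      moreover have "q \<le> p'" using count_less_iff[of "\<lambda>x. 0 < x" xs p' q] p ran by linarith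
      ultimately have "cneg xs q = cneg xs p"
        using p q by (intro count_cong) (auto simp: not_less intro!: less_imp_le)
      then show ?thesis using ht[of p] p by simp
    qed
    \<comment> \<open>Dually, extending the prefix to length \<open>Suc p'\<close> adds only
      negative entries and brings their number to \<open>b'\<close>.\<close>
    have dn': "neg_sum xs b' \<le> pos_sum xs ?A"
      if lev_ab: "level xs a b < 0" and ran: "b \<le> ?B" "?B < b'"
    proof -
      obtain p p' where p: "p < length xs" "p' < length xs"
        "cneg xs p = b - 1" "cneg xs p' = b' - 1" "xs ! p' < 0" "xs ! p < 0"
        "\<And>m. p \<le> m \<Longrightarrow> m \<le> p' \<Longrightarrow> xs ! m < 0"
        using dn[OF lev_ab] by blast
      have "b \<noteq> 0" using greedy_level_neg[OF g(1)] lev_ab by blast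
      then have "p < q" using count_less_iff[of "\<lambda>x. x < 0" xs p q] p ran by linarith
      moreover have "q \<le> p'" using count_less_iff[of "\<lambda>x. x < 0" xs p' q] p ran by linarith
      ultimately have "cpos xs (Suc p') = cpos xs q"
        using p q by (intro count_cong) (auto simp: not_less less_Suc_eq_le intro!: less_imp_le)
      moreover have "cneg xs (Suc p') = b'" using p ran by (simp add: count_Suc)
      ultimately show ?thesis using ht[of "Suc p'"] p by simp
    qed
    show "0 \<le> sum_list (nths (take q xs) ?I) \<and> sum_list (nths (take q xs) ?I) \<le> sum_list (take q xs)"
      unfolding sum_list_nths_window[OF le q] sum_list_take_eq
      using window_sum_bounds[OF g le lev count_le count_le ht[OF q] up' dn'] by blast
  qed
qed

section \<open>Counting the levels seen by each run\<close>

lemma runs_sgn_eq: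
  assumes "k < length (runs xs)" "x \<in> set (runs xs ! k)" "z \<in> set (runs xs ! k)"
  shows "sgn x = sgn z"
  using runs_same_sign[OF nth_mem[OF assms(1)]] assms(2,3) by metis

text \<open>Neighbouring runs differ in sign and no entry is 0, so two of the first four runs are
  negative. The second one supplies a code that no time attains.\<close>

lemma two_negative_runs:
  assumes "0 \<notin> set xs" "4 \<le> length (runs xs)"
  obtains k k' x z where "k < length (runs xs)" "k' < length (runs xs)" "k \<noteq> k'"
    "x \<in> set (runs xs ! k)" "x < 0" "z \<in> set (runs xs ! k')" "z < 0"
proof -
  let ?h = "\<lambda>k. hd (runs xs ! k)"
  have mem: "?h k \<in> set (runs xs ! k)" and nz: "?h k \<noteq> 0" if "k < length (runs xs)" for k
  proof -
    show *: "?h k \<in> set (runs xs ! k)"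
      using runs_same_sign[OF nth_mem[OF that]] by simp
    have "?h k \<in> set (concat (runs xs))" using * nth_mem[OF that] by auto
    then show "?h k \<noteq> 0" using assms(1) by (metis concat_runs)
  qed
  have alt: "sgn (?h k) \<noteq> sgn (?h (Suc k))" if "Suc k < length (runs xs)" for k
    by (rule runs_maximal[OF that])
  show ?thesis
  proof (cases "?h 0 < 0")
    case True
    have "?h 2 < 0"
      using True alt[of 0] alt[of 1] nz[of 1] nz[of 2] assms(2)
      by (auto simp: sgn_if numeral_2_eq_2 split: if_splits)
    then show ?thesis using True that[of 0 2 "?h 0" "?h 2"] mem[of 0] mem[of 2] assms(2) by force
  next
    case False
    have "?h 1 < 0"
      using False alt[of 0] nz[of 0] nz[of 1] assms(2)
      by (fastforce simp: sgn_if split: if_splits)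
    moreover from this have "?h 3 < 0"
      using alt[of 1] alt[of 2] nz[of 2] nz[of 3] assms(2)
      by (auto simp: sgn_if numeral_2_eq_2 numeral_3_eq_3 split: if_splits)
    ultimately show ?thesis using that[of 1 3 "?h 1" "?h 3"] mem[of 1] mem[of 3] assms(2) by simp
  qed
qed

theorem theorem3p1:
  fixes xs :: "int list" and y :: nat
  assumes "gen_catalan xs"
    and "length (runs xs) = 2 * y"
    and "cost xs = int (width xs)"
    and "y > 1"
  shows "reducible xs"
proof -
  have nz: "0 \<notin> set xs" and sum0: "sum_list xs = 0"
    using assms(1) by (auto simp: gen_catalan_def)
  note len = length_eq_num_pos_neg[OF nz]
  let ?L = "length (runs xs)"
  define M where "M k = Max (abs ` set (runs xs ! k))" for k
  have M: "\<bar>x\<bar> \<le> M k" if "x \<in> set (runs xs ! k)" for x k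
    using that by (simp add: M_def)

  obtain f where f: "\<And>i. i < length xs \<Longrightarrow> f i < ?L \<and> xs ! i \<in> set (runs xs ! f i)"
    and f_mono: "\<And>i j. i \<le> j \<Longrightarrow> f i \<le> f j"
    using concat_index_exists[of "runs xs"] unfolding concat_runs by blast
  have same_run: "sgn (xs ! m) = sgn (xs ! i)"
    if "i \<le> m" "m \<le> j" "j < length xs" "f i = f j" for i m j
  proof -
    have "f m = f i" using f_mono[OF that(1)] f_mono[OF that(2)] that(4) by simp
    then show ?thesis using runs_sgn_eq[of "f i" xs "xs ! m" "xs ! i"] f[of m] f[of i] that by simp
  qed

  have "\<forall>j. \<exists>p. j < num_pos xs \<longrightarrow> p < length xs \<and> 0 < xs ! p \<and> cpos xs p = j \<and>
      filter (\<lambda>x. 0 < x) xs ! j = xs ! p"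
    by (blast elim: filter_nth_obtain)
  then obtain pp where pp: "\<And>j. j < num_pos xs \<Longrightarrow> pp j < length xs \<and> 0 < xs ! pp j \<and>
      cpos xs (pp j) = j \<and> filter (\<lambda>x. 0 < x) xs ! j = xs ! pp j"
    by metis
  have "\<forall>j. \<exists>p. j < num_neg xs \<longrightarrow> p < length xs \<and> xs ! p < 0 \<and> cneg xs p = j \<and>
      filter (\<lambda>x. x < 0) xs ! j = xs ! p"
    by (blast elim: filter_nth_obtain)
  then obtain pn where pn: "\<And>j. j < num_neg xs \<Longrightarrow> pn j < length xs \<and> xs ! pn j < 0 \<and>
      cneg xs (pn j) = j \<and> filter (\<lambda>x. x < 0) xs ! j = xs ! pn j"
    by metis

  have "\<forall>t. \<exists>a b. t \<le> length xs \<longrightarrow> a + b = t \<and> greedy xs a b"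
    using greedy_exists[OF sum0] len by auto
  then obtain a b where ab: "\<And>t. t \<le> length xs \<Longrightarrow> a t + b t = t \<and> greedy xs (a t) (b t)"
    by metis
  define lv where "lv t = level xs (a t) (b t)" for t

  \<comment> \<open>Without the last positive entry taken the level would be at most 0, so a
    positive level is at most that entry.\<close>
  have pos: "a t - 1 < num_pos xs \<and> a t \<noteq> 0 \<and> lv t \<le> xs ! pp (a t - 1)"
    if "t \<le> length xs" "0 < lv t" for t
  proof -
    have g: "greedy xs (a t) (b t)" using ab that by simp
    have "a t \<noteq> 0" using greedy_level_pos[OF g] that(2) by (simp add: lv_def)
    then obtain c where c: "a t = Suc c" by (cases "a t") auto
    then have "c < num_pos xs" "pos_sum xs c \<le> neg_sum xs (b t)"
      using g by (auto simp: greedy_def)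
    then show ?thesis using c pp[of c] by (simp add: lv_def level_def pos_sum_Suc)
  qed
  \<comment> \<open>Without the last negative entry taken the level would be positive, hence the
    strict inequality.\<close>
  have neg: "b t - 1 < num_neg xs \<and> b t \<noteq> 0 \<and> - lv t < - (xs ! pn (b t - 1))"
    if "t \<le> length xs" "lv t < 0" for t
  proof -
    have g: "greedy xs (a t) (b t)" using ab that by simp
    have "b t \<noteq> 0" using greedy_level_neg[OF g] that(2) by (simp add: lv_def)
    then obtain c where c: "b t = Suc c" by (cases "b t") auto
    then have "c < num_neg xs" "neg_sum xs c < pos_sum xs (a t)"
      using g by (auto simp: greedy_def)
    then show ?thesis using c pn[of c] by (simp add: lv_def level_def neg_sum_Suc)
  qed

  obtain k0 k1 x0 x1 where k: "k0 < ?L" "k1 < ?L" "k0 \<noteq> k1"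
    "x0 \<in> set (runs xs ! k0)" "x0 < 0" "x1 \<in> set (runs xs ! k1)" "x1 < 0"
    by (rule two_negative_runs[OF nz]) (use assms(2,4) in auto)
  \<comment> \<open>Level 0 is shared by all runs, so \<open>(k0, 0)\<close> is the only code of the form \<open>(k, 0)\<close> with \<open>k\<close> a
    negative run. Hence \<open>(k1, 0)\<close> is missed.\<close>
  define code where "code t = (if 0 < lv t then (f (pp (a t - 1)), lv t - 1)
    else if lv t < 0 then (f (pn (b t - 1)), - lv t) else (k0, 0))" for t
  \<comment> \<open>Positive runs use the level minus 1 and negative runs the negated level, so both
    fit into \<open>{0..<M k}\<close>, and offset 0 in a negative run is left for level 0. Thus
    \<open>T\<close> has as many elements as the cost.\<close>
  define T where "T = Sigma {..<?L} (\<lambda>k. {0..<M k})"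
  have "int (card T) = (\<Sum>k<?L. int (nat (M k)))"
    by (simp add: T_def)
  also have "\<dots> = (\<Sum>k<?L. M k)"
  proof (rule sum.cong)
    fix k
    assume "k \<in> {..<?L}"
    then have "hd (runs xs ! k) \<in> set (runs xs ! k)"
      using runs_same_sign[OF nth_mem[of k "runs xs"]] by simp
    then show "int (nat (M k)) = M k" using M by fastforce
  qed simp
  also have "\<dots> = int (length xs)"
    using assms(3) by (simp add: cost_def width_def M_def)
  finally have card_T: "card T = length xs" by simp

  \<comment> \<open>The sign of the run named by \<open>code t\<close> tells whether
    \<open>lv t\<close> is positive; level 0 goes with the negative runs through
    \<open>k0\<close>.\<close>
  have code_pos: "\<exists>x\<in>set (runs xs ! fst (code t)). 0 < x \<and> lv t \<le> x \<and> fst (code t) < ?L"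
    if "t \<le> length xs" "0 < lv t" for t
    using pos[OF that] pp[of "a t - 1"] f[of "pp (a t - 1)"] that
    by (intro bexI[of _ "xs ! pp (a t - 1)"]) (auto simp: code_def)
  have code_neg: "\<exists>x\<in>set (runs xs ! fst (code t)). x < 0 \<and> - lv t < - x \<and> fst (code t) < ?L"
    if "t \<le> length xs" "lv t \<le> 0" for t
  proof (cases "lv t = 0")
    case True
    then show ?thesis using k by (auto simp: code_def)
  next
    case False
    then have "lv t < 0" using that by simp
    then show ?thesis
      using neg[OF that(1)] pn[of "b t - 1"] f[of "pn (b t - 1)"] that
      by (intro bexI[of _ "xs ! pn (b t - 1)"]) (auto simp: code_def)
  qed

  have "code t \<in> T - {(k1, 0)}" if t_lt: "t < length xs" for t
  proof (cases "0 < lv t")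
    case True
    then obtain x where x: "x \<in> set (runs xs ! fst (code t))" "0 < x" "lv t \<le> x" "fst (code t) < ?L"
      using code_pos[of t] t_lt by auto
    have "fst (code t) \<noteq> k1"
      using runs_sgn_eq[of k1 xs x x1] x k by auto
    moreover have "snd (code t) = lv t - 1" using True by (simp add: code_def)
    ultimately show ?thesis using M[OF x(1)] x True
      by (cases "code t") (auto simp: T_def)
  next
    case False
    then obtain x where x: "x \<in> set (runs xs ! fst (code t))" "x < 0" "- lv t < - x" "fst (code t) < ?L"
      using code_neg[of t] t_lt by auto
    moreover have "snd (code t) = - lv t" using False by (simp add: code_def)
    moreover have "code t \<noteq> (k1, 0)" using False k by (auto simp: code_def)
    ultimately show ?thesis using M[OF x(1)] False
      by (cases "code t") (auto simp: T_def)
  qed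
  then have "code ` {..<length xs} \<subseteq> T - {(k1, 0)}" by (meson image_subsetI lessThan_iff)
  moreover have "finite T" by (simp add: T_def)
  moreover have "(k1, 0) \<in> T" using k M[OF k(6)] by (auto simp: T_def)
  ultimately have "card (code ` {..<length xs}) < card {..<length xs}"
    using card_T card_Diff1_less[of T "(k1, 0)"] card_mono[of "T - {(k1, 0)}" "code ` {..<length xs}"]
    by simp
  then have "\<not> inj_on code {..<length xs}" by (rule pigeonhole)
  then obtain t t' where t: "t < t'" "t' < length xs" "code t = code t'"
    by (auto simp: inj_on_def) (metis linorder_neqE_nat)

  have t_le: "t \<le> length xs" "t' \<le> length xs" using t by auto
  \<comment> \<open>Equal codes name the same run, which has only one sign. Once positivity agrees,
    the second components determine the level.\<close>
  have "0 < lv t \<longleftrightarrow> 0 < lv t'"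
  proof (rule ccontr)
    assume "\<not> (0 < lv t \<longleftrightarrow> 0 < lv t')"
    then obtain x z where "x \<in> set (runs xs ! fst (code t))" "0 < x"
      "z \<in> set (runs xs ! fst (code t))" "z < 0" "fst (code t) < ?L"
      using code_pos[OF t_le(1)] code_pos[OF t_le(2)] code_neg[OF t_le(1)] code_neg[OF t_le(2)] t(3)
      by (metis not_le)
    then show False using runs_sgn_eq[of "fst (code t)" xs x z] by auto
  qed
  then have lv_eq: "lv t = lv t'"
    using arg_cong[OF t(3), of snd] by (auto simp: code_def split: if_splits)

  show ?thesis
  proof (rule reducible_collision[OF assms(1), of "a t" "b t" "a t'" "b t'"])
    show "greedy xs (a t) (b t)" "greedy xs (a t') (b t')"
      "a t + b t < a t' + b t'" "a t' + b t' < length xs"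
      using ab t t_le by auto
    show "level xs (a t) (b t) = level xs (a t') (b t')" using lv_eq by (simp add: lv_def)
  next
    assume "0 < level xs (a t) (b t)"
    then have *: "0 < lv t" "0 < lv t'" using lv_eq by (auto simp: lv_def)
    let ?p = "pp (a t - 1)" and ?p' = "pp (a t' - 1)"
    have p: "?p < length xs \<and> 0 < xs ! ?p \<and> cpos xs ?p = a t - 1"
      "?p' < length xs \<and> 0 < xs ! ?p' \<and> cpos xs ?p' = a t' - 1"
      using pp pos[OF t_le(1) *(1)] pos[OF t_le(2) *(2)] by auto
    moreover have "f ?p = f ?p'" using t(3) * by (simp add: code_def)
    then have "0 < xs ! m" if "?p \<le> m" "m \<le> ?p'" for m
      using same_run[OF that] p by (metis sgn_greater)
    ultimately show "\<exists>p p'. p < length xs \<and> p' < length xs \<and>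
      cpos xs p = a t - 1 \<and> cpos xs p' = a t' - 1 \<and> 0 < xs ! p' \<and> 0 < xs ! p \<and>
      (\<forall>m. p \<le> m \<and> m \<le> p' \<longrightarrow> 0 < xs ! m)"
      by blast
  next
    assume "level xs (a t) (b t) < 0"
    then have *: "lv t < 0" "lv t' < 0" using lv_eq by (auto simp: lv_def)
    let ?p = "pn (b t - 1)" and ?p' = "pn (b t' - 1)"
    have p: "?p < length xs \<and> xs ! ?p < 0 \<and> cneg xs ?p = b t - 1"
      "?p' < length xs \<and> xs ! ?p' < 0 \<and> cneg xs ?p' = b t' - 1"
      using pn neg[OF t_le(1) *(1)] neg[OF t_le(2) *(2)] by auto
    moreover have "f ?p = f ?p'" using t(3) * by (simp add: code_def)
    then have "xs ! m < 0" if "?p \<le> m" "m \<le> ?p'" for m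
      using same_run[OF that] p by (metis sgn_less)
    ultimately show "\<exists>p p'. p < length xs \<and> p' < length xs \<and>
      cneg xs p = b t - 1 \<and> cneg xs p' = b t' - 1 \<and> xs ! p' < 0 \<and> xs ! p < 0 \<and>
      (\<forall>m. p \<le> m \<and> m \<le> p' \<longrightarrow> xs ! m < 0)"
      by blast
  qed
qed

end
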